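(* Let $G=(V,E)$ be a locally finite simple graph and let $\mathcal K_{G,x}:(0,\infty]\to\mathbb R$ be the curvature function of $x\in V$. Then $$d_x=-\frac12\lim_{\mathcal N\to0}\mathcal N\,\mathcal K_{G,x}(\mathcal N).$$
   Context: Graphs are undirected, without loops or multiple edges, and every vertex has finite degree; $d_x$ is the degree of $x$, and the vertex $x$ considered has $d_x\ge1$. For $f:V\to\mathbb R$ put $\Delta f(x)=\sum_{y\sim x}(f(y)-f(x))$ (non-normalized Laplacian), and for $f,g:V\to\mathbb R$ put $2\Gamma(f,g)=\Delta(fg)-f\Delta g-g\Delta f$, $2\Gamma_2(f,g)=\Delta\Gamma(f,g)-\Gamma(f,\Delta g)-\Gamma(\Delta f,g)$, $\Gamma(f)=\Gamma(f,f)$, $\Gamma_2(f)=\Gamma_2(f,f)$. For $\mathcal N\in(0,\infty]$ (convention $1/\infty=0$), $\mathcal K_{G,x}(\mathcal N)$ is the largest $K\in\mathbb R$ such that $\Gamma_2(f)(x)\ge\frac1{\mathcal N}(\Delta f(x))^2+K\,\Gamma(f)(x)$ for all $f:V\to\mathbb R$ (Bakry-Émery curvature function). *)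

theory Defs
  imports "HOL-Analysis.Analysis"
begin

definition nbrs :: "'v set set \<Rightarrow> 'v \<Rightarrow> 'v set" where
  "nbrs E x = {y. {x, y} \<in> E}"

text \<open>
  Edges are two-element sets of vertices, so that loops, multiple edges and orientations
  are excluded. The graph may be infinite and need not be connected.
\<close>

locale locally_finite_simple_graph =
  fixes V :: "'v set" and E :: "'v set set"
  assumes edge: "e \<in> E \<Longrightarrow> e \<subseteq> V \<and> card e = 2"
    and locally_finite: "x \<in> V \<Longrightarrow> finite (nbrs E x)"

definition vertex_degree :: "'v set set \<Rightarrow> 'v \<Rightarrow> nat" where
  "vertex_degree E x = card (nbrs E x)"

text \<open>
  Functions on \<open>V\<close> are represented by functions on the whole type \<open>'v\<close>. All neighbours of a
  vertex lie in \<open>V\<close>, so at a vertex the operators below depend only on the values on \<open>V\<close>,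
  and quantifying over all functions on \<open>'v\<close> amounts to quantifying over all functions on \<open>V\<close>.
\<close>

definition laplacian :: "'v set set \<Rightarrow> ('v \<Rightarrow> real) \<Rightarrow> 'v \<Rightarrow> real" where
  "laplacian E f x = (\<Sum>y\<in>nbrs E x. f y - f x)"

definition Gam :: "'v set set \<Rightarrow> ('v \<Rightarrow> real) \<Rightarrow> ('v \<Rightarrow> real) \<Rightarrow> 'v \<Rightarrow> real" where
  "Gam E f g x =
     (laplacian E (\<lambda>y. f y * g y) x - f x * laplacian E g x - g x * laplacian E f x) / 2"

definition Gam2 :: "'v set set \<Rightarrow> ('v \<Rightarrow> real) \<Rightarrow> ('v \<Rightarrow> real) \<Rightarrow> 'v \<Rightarrow> real" where
  "Gam2 E f g x =
     (laplacian E (Gam E f g) x - Gam E f (laplacian E g) x - Gam E (laplacian E f) g x) / 2"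

text \<open>
  The dimension parameter ranges over \<open>(0, \<infinity>]\<close>; in \<^typ>\<open>ereal\<close> the convention
  \<open>1 / \<infinity> = 0\<close> holds.
\<close>

definition curvature_dimension :: "'v set set \<Rightarrow> 'v \<Rightarrow> real \<Rightarrow> ereal \<Rightarrow> bool" where
  "curvature_dimension E x K N \<longleftrightarrow>
     (\<forall>f. Gam2 E f f x \<ge> real_of_ereal (1 / N) * (laplacian E f x)\<^sup>2 + K * Gam E f f x)"

definition curvature_fun :: "'v set set \<Rightarrow> 'v \<Rightarrow> ereal \<Rightarrow> real" where
  "curvature_fun E x N = (GREATEST K. curvature_dimension E x K N)"

end

theory Submission
  imports Defs
begin

text \<open>
  Cauchy--Schwarz gives \<open>(\<Delta>f(x))\<^sup>2 \<le> 2 d\<^sub>x \<Gamma>(f)(x)\<close>, so a curvature bound \<open>K\<^sub>0\<close> for dimension \<open>\<infinity>\<close>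
  yields the bound \<open>K\<^sub>0 - 2 d\<^sub>x / N\<close> for dimension \<open>N\<close>; such a \<open>K\<^sub>0\<close> always exists.
  Conversely, Cauchy--Schwarz is an equality for the function that vanishes at \<open>x\<close> and equals \<open>1\<close>
  elsewhere, which gives an upper bound \<open>C - 2 d\<^sub>x / N\<close>. Multiply by \<open>N\<close> and let \<open>N \<rightarrow> 0\<close>.
\<close>

text \<open>For each neighbour \<open>y\<close>, the increment of the product \<open>f * g\<close>
  minus the two Leibniz terms factors as the product of the increments of \<open>f\<close> and
  \<open>g\<close>.\<close>

lemma Gam_eq_sum: "Gam E f g x = (\<Sum>y\<in>nbrs E x. (f y - f x) * (g y - g x)) / 2"
  unfolding Gam_def laplacian_def sum_distrib_left sum_subtractf[symmetric]
  by (intro arg_cong[where f="\<lambda>s. s / 2"] sum.cong) (auto simp: algebra_simps)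

lemma Gam_commute: "Gam E f g x = Gam E g f x"
  by (simp add: Gam_eq_sum mult.commute)

lemma Gam_self: "Gam E f f x = (\<Sum>y\<in>nbrs E x. (f y - f x)\<^sup>2) / 2"
  by (simp add: Gam_eq_sum power2_eq_square)

lemma laplacian_square_le:
  "(laplacian E f x)\<^sup>2 \<le> 2 * real (vertex_degree E x) * Gam E f f x"
  using sum_squared_le_sum_of_squares[of "\<lambda>y. f y - f x" "nbrs E x"]
  by (simp add: laplacian_def Gam_self vertex_degree_def mult.commute)

text \<open>Everything is reduced to increments along the paths \<open>x\<close>, \<open>y\<close>,
  \<open>z\<close> of length two. The mixed term \<open>Gam E f (laplacian E f) x\<close> supplies
  the square of the Laplacian: its part with the constant \<open>laplacian E f x\<close> sums to
  that square.\<close>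

lemma two_Gam2_eq:
  "2 * Gam2 E f f x =
     (\<Sum>y\<in>nbrs E x. \<Sum>z\<in>nbrs E y. (f z - f y)\<^sup>2 / 2 - (f y - f x) * (f z - f y))
     - real (vertex_degree E x) * Gam E f f x + (laplacian E f x)\<^sup>2"
proof -
  have "2 * Gam2 E f f x = laplacian E (Gam E f f) x - 2 * Gam E f (laplacian E f) x"
    by (simp add: Gam2_def Gam_commute[of E "laplacian E f" f])
  also have "laplacian E (Gam E f f) x =
      (\<Sum>y\<in>nbrs E x. Gam E f f y) - real (vertex_degree E x) * Gam E f f x"
    by (simp add: laplacian_def[of E "Gam E f f"] sum_subtractf vertex_degree_def)
  also have "2 * Gam E f (laplacian E f) x =
      (\<Sum>y\<in>nbrs E x. (f y - f x) * laplacian E f y) - (laplacian E f x)\<^sup>2"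
    by (simp add: Gam_eq_sum right_diff_distrib sum_subtractf sum_distrib_right[symmetric]
        laplacian_def[of E f x] power2_eq_square)
  also have "(\<Sum>y\<in>nbrs E x. Gam E f f y) = (\<Sum>y\<in>nbrs E x. \<Sum>z\<in>nbrs E y. (f z - f y)\<^sup>2 / 2)"
    by (simp only: Gam_self sum_divide_distrib)
  also have "(\<Sum>y\<in>nbrs E x. (f y - f x) * laplacian E f y) =
      (\<Sum>y\<in>nbrs E x. \<Sum>z\<in>nbrs E y. (f y - f x) * (f z - f y))"
    by (simp only: laplacian_def sum_distrib_left)
  finally show ?thesis
    by (simp add: sum_subtractf)
qed

text \<open>Completing the square in \<open>f z - f y\<close> bounds each two-step term below by a
  multiple of \<open>(f y - f x)\<^sup>2\<close>, hence their sum by a multiple of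
  \<open>Gam E f f x\<close>. The square of the Laplacian is dropped. The constant depends on
  degrees only, not on \<open>f\<close>.\<close>

lemma Gam2_ge:
  assumes "finite (nbrs E x)"
  shows "Gam2 E f f x \<ge>
    - ((\<Sum>y\<in>nbrs E x. real (vertex_degree E y)) + real (vertex_degree E x)) / 2 * Gam E f f x"
proof -
  let ?M = "\<Sum>y\<in>nbrs E x. real (vertex_degree E y)"
  have pointwise: "(\<Sum>z\<in>nbrs E y. (f z - f y)\<^sup>2 / 2 - (f y - f x) * (f z - f y))
      \<ge> - ?M * ((f y - f x)\<^sup>2 / 2)" if "y \<in> nbrs E x" for y
  proof -
    \<comment> \<open>The sum of the degrees serves as a common upper bound for the degrees of all
      neighbours.\<close>
    have "real (vertex_degree E y) \<le> ?M"
      using member_le_sum[of y "nbrs E x" "\<lambda>y. real (vertex_degree E y)"] that assms by simp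
    then have "- ?M * ((f y - f x)\<^sup>2 / 2) \<le> - real (vertex_degree E y) * ((f y - f x)\<^sup>2 / 2)"
      by (intro mult_right_mono) auto
    also have "\<dots> = (\<Sum>z\<in>nbrs E y. - ((f y - f x)\<^sup>2 / 2))"
      by (simp add: vertex_degree_def)
    also have "\<dots> \<le> (\<Sum>z\<in>nbrs E y. (f z - f y)\<^sup>2 / 2 - (f y - f x) * (f z - f y))"
    proof (rule sum_mono)
      fix z
      \<comment> \<open>With a = \<open>f y - f x\<close> and b = \<open>f z - f y\<close> this is
        2ab \<le> a^2 + b^2, divided by 2.\<close>
      show "- ((f y - f x)\<^sup>2 / 2) \<le> (f z - f y)\<^sup>2 / 2 - (f y - f x) * (f z - f y)"
        using sum_squares_bound[of "f y - f x" "f z - f y"] unfolding mult.assoc by linarith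
    qed
    finally show ?thesis .
  qed
  have "- ?M * Gam E f f x = (\<Sum>y\<in>nbrs E x. - ?M * ((f y - f x)\<^sup>2 / 2))"
    by (simp only: Gam_self sum_divide_distrib sum_distrib_left)
  also have "\<dots> \<le> (\<Sum>y\<in>nbrs E x. \<Sum>z\<in>nbrs E y. (f z - f y)\<^sup>2 / 2 - (f y - f x) * (f z - f y))"
    using pointwise by (rule sum_mono)
  finally have "- ?M * Gam E f f x \<le> 2 * Gam2 E f f x + real (vertex_degree E x) * Gam E f f x"
    using two_Gam2_eq[of E f x] zero_le_power2[of "laplacian E f x"] by linarith
  then show ?thesis by (simp add: algebra_simps)
qed

lemma curvature_dimension_finite_dim:
  fixes N :: real
  assumes "0 < N" and "\<And>f. K * Gam E f f x \<le> Gam2 E f f x"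
  shows "curvature_dimension E x (K - 2 * real (vertex_degree E x) / N) (ereal N)"
  unfolding curvature_dimension_def
proof
  fix f
  have "(laplacian E f x)\<^sup>2 / N \<le> 2 * real (vertex_degree E x) * Gam E f f x / N"
    using laplacian_square_le assms(1) by (intro divide_right_mono) auto
  then show "real_of_ereal (1 / ereal N) * (laplacian E f x)\<^sup>2
      + (K - 2 * real (vertex_degree E x) / N) * Gam E f f x \<le> Gam2 E f f x"
    using assms(2)[of f] assms(1) by (simp add: one_ereal_def algebra_simps)
qed

text \<open>\<open>GREATEST\<close> is informative only if a maximum is attained. A nonempty closed
  set of reals that is bounded above contains its supremum, which is then that maximum.\<close>

lemma Greatest_closed_bounded:
  fixes P :: "real \<Rightarrow> bool"
  assumes "closed {K. P K}" and "P K\<^sub>0" and "\<And>K. P K \<Longrightarrow> K \<le> B"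
  shows "P (Greatest P)" and "\<And>K. P K \<Longrightarrow> K \<le> Greatest P"
proof -
  have bdd: "bdd_above {K. P K}" using assms(3) by (auto intro: bdd_aboveI[of _ B])
  have "Sup {K. P K} \<in> {K. P K}"
    using closed_contains_Sup[OF _ bdd assms(1)] assms(2) by auto
  moreover have "K \<le> Sup {K. P K}" if "P K" for K
    using cSup_upper[OF _ bdd] that by simp
  ultimately show "P (Greatest P)" and "\<And>K. P K \<Longrightarrow> K \<le> Greatest P"
    by (auto intro: GreatestI2_order)
qed

text \<open>For each \<open>f\<close> the condition is a non-strict inequality affine in
  \<open>K\<close>, and an intersection of closed sets is closed.\<close>

lemma closed_curvature_dimension: "closed {K. curvature_dimension E x K N}"
  unfolding curvature_dimension_def
  by (intro closed_Collect_all closed_Collect_le continuous_intros)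

lemma curvature_dimension_le:
  fixes N :: real
  assumes "x \<notin> nbrs E x" and "0 < vertex_degree E x" and "0 < N"
    and "curvature_dimension E x K (ereal N)"
  shows "K \<le> 2 * Gam2 E (\<lambda>y. of_bool (y \<noteq> x)) (\<lambda>y. of_bool (y \<noteq> x)) x / real (vertex_degree E x)
    - 2 * real (vertex_degree E x) / N"
proof -
  let ?f = "\<lambda>y. of_bool (y \<noteq> x) :: real" and ?d = "real (vertex_degree E x)"
  have diff: "?f y - ?f x = 1" if "y \<in> nbrs E x" for y
    using that assms(1) by auto
  \<comment> \<open>All increments at \<open>x\<close> are 1, so both sums just count
    neighbours.\<close>
  have eqs: "laplacian E ?f x = ?d" "Gam E ?f ?f x = ?d / 2"
    by (simp_all only: laplacian_def Gam_self vertex_degree_def diff cong: sum.cong) simp_all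
  have "real_of_ereal (1 / ereal N) * (laplacian E ?f x)\<^sup>2 + K * Gam E ?f ?f x \<le> Gam2 E ?f ?f x"
    using assms(4) unfolding curvature_dimension_def by blast
  then have "?d\<^sup>2 / N + K * (?d / 2) \<le> Gam2 E ?f ?f x"
    using assms(3) unfolding eqs by (simp add: one_ereal_def)
  then show ?thesis
    using assms(2,3) by (simp add: field_simps power2_eq_square)
qed

theorem corollary4p4:
  fixes V :: "'v set" and E :: "'v set set" and x :: 'v
  assumes "locally_finite_simple_graph V E"
    and "x \<in> V"
    and "vertex_degree E x \<ge> 1"
  shows "\<exists>L. ((\<lambda>N::real. N * curvature_fun E x (ereal N)) \<longlongrightarrow> L) (at_right 0) \<and>
             real (vertex_degree E x) = - (1 / 2) * L"
proof -
  interpret locally_finite_simple_graph V E by fact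
  let ?d = "real (vertex_degree E x)"
  have irrefl: "x \<notin> nbrs E x"
    using edge[of "{x, x}"] by (auto simp: nbrs_def)
  have pos: "0 < vertex_degree E x" using assms(3) by simp
  obtain K\<^sub>0 where K\<^sub>0: "\<And>f. K\<^sub>0 * Gam E f f x \<le> Gam2 E f f x"
    using Gam2_ge[OF locally_finite[OF assms(2)]] by blast
  \<comment> \<open>The test function does not involve \<open>N\<close>, so one \<open>C\<close>
    serves every dimension.\<close>
  obtain C where C: "\<And>K N. 0 < N \<Longrightarrow> curvature_dimension E x K (ereal N) \<Longrightarrow> K \<le> C - 2 * ?d / N"
    using curvature_dimension_le[OF irrefl pos] by blast
  have bounds: "N * K\<^sub>0 - 2 * ?d \<le> N * curvature_fun E x (ereal N)"
    "N * curvature_fun E x (ereal N) \<le> N * C - 2 * ?d" if N: "0 < N" for N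
  proof -
    \<comment> \<open>This admissible bound shows that the set of admissible \<open>K\<close> is
      nonempty, and it also gives the lower estimate of its maximum.\<close>
    note low = curvature_dimension_finite_dim[OF N K\<^sub>0]
    have greatest: "curvature_dimension E x (curvature_fun E x (ereal N)) (ereal N)"
      and upper: "K \<le> curvature_fun E x (ereal N)" if "curvature_dimension E x K (ereal N)" for K
      unfolding curvature_fun_def
      using Greatest_closed_bounded[OF closed_curvature_dimension low] C[OF N] that by blast+
    have "N * (K\<^sub>0 - 2 * ?d / N) \<le> N * curvature_fun E x (ereal N)"
      using upper[OF low] N by (intro mult_left_mono) auto
    then show "N * K\<^sub>0 - 2 * ?d \<le> N * curvature_fun E x (ereal N)"
      using N by (simp add: right_diff_distrib)
    have "N * curvature_fun E x (ereal N) \<le> N * (C - 2 * ?d / N)"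
      using C[OF N greatest[OF low]] N by (intro mult_left_mono) auto
    then show "N * curvature_fun E x (ereal N) \<le> N * C - 2 * ?d"
      using N by (simp add: right_diff_distrib)
  qed
  have lim: "((\<lambda>N. N * c - 2 * ?d) \<longlongrightarrow> - 2 * ?d) (at_right 0)" for c
    by (rule tendsto_eq_intros refl | simp)+
  \<comment> \<open>Both bounds are affine in \<open>N\<close> with the same constant term, so they
    squeeze the product.\<close>
  have "((\<lambda>N. N * curvature_fun E x (ereal N)) \<longlongrightarrow> - 2 * ?d) (at_right 0)"
    using bounds
    by (intro tendsto_sandwich[OF _ _ lim[of K\<^sub>0] lim[of C]])
      (auto intro!: eventually_mono[OF eventually_at_right_less])
  then show ?thesis by (intro exI[of _ "- 2 * ?d"]) simp
qed

end
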